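(* Let $\varphi$ be an LTL formula over $V = I \cup O$, and suppose $\mathrm{isDependent}(z,Y)$ returns true if and only if $\{z\}$ is dependent on $Y$ in $\varphi$. Consider the procedure FindDependent: start with $X = \emptyset$; for each $z \in O$ in turn (each considered once, in some order), if $\mathrm{isDependent}(z, V \setminus (X \cup \{z\}))$ then set $X := X \cup \{z\}$; finally return $X$. Then FindDependent returns a maximal dependent set in $\varphi$.
   Context: Letters are assignments to $V$; $a.Z$ is the restriction of letter $a$ to $Z \subseteq V$; for an infinite word $w$, $w[0,i] = w_0\cdots w_i$ and $w[0,-1]$ is empty. $X \subseteq O$ is dependent on $Y$ in $\varphi$ if for all $w,w' \in L(\varphi)$ and $i\ge 0$, $w[0,i-1]=w'[0,i-1]$ and $w_i.Y=w'_i.Y$ imply $w_i.X = w'_i.X$; $X$ is dependent in $\varphi$ if it is dependent on $V\setminus X$; $X$ is a maximal dependent set in $\varphi$ if $X$ is dependent in $\varphi$ and no set $X' \subseteq O$ strictly containing $X$ is dependent in $\varphi$. *)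

theory Defs
  imports Main "HOL-Library.FuncSet" "HOL-Library.Omega_Words_Fun"
begin

(* The remaining connectives (or, implies, finally, globally, release, ...) are derived. *)
datatype 'v ltl =
    True_ltl
  | Prop_ltl 'v
  | Not_ltl "'v ltl"
  | And_ltl "'v ltl" "'v ltl"
  | Next_ltl "'v ltl"
  | Until_ltl "'v ltl" "'v ltl"

(* set_ltl, generated by the datatype package, is the set of variables of a formula. *)

primrec models_ltl :: "('v \<Rightarrow> bool) word \<Rightarrow> 'v ltl \<Rightarrow> bool" where
  "models_ltl w True_ltl = True"
| "models_ltl w (Prop_ltl v) = w 0 v"
| "models_ltl w (Not_ltl \<phi>) = (\<not> models_ltl w \<phi>)"
| "models_ltl w (And_ltl \<phi> \<psi>) = (models_ltl w \<phi> \<and> models_ltl w \<psi>)"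
| "models_ltl w (Next_ltl \<phi>) = models_ltl (suffix 1 w) \<phi>"
| "models_ltl w (Until_ltl \<phi> \<psi>) =
     (\<exists>i. models_ltl (suffix i w) \<psi> \<and> (\<forall>j<i. models_ltl (suffix j w) \<phi>))"

(* Assignments to V are extensional functions, so that equality of letters
   is agreement on V. *)
definition letters :: "'v set \<Rightarrow> ('v \<Rightarrow> bool) set" where
  "letters V = V \<rightarrow>\<^sub>E (UNIV :: bool set)"

definition language :: "'v set \<Rightarrow> 'v ltl \<Rightarrow> ('v \<Rightarrow> bool) word set" where
  "language V \<phi> = {w. (\<forall>i. w i \<in> letters V) \<and> models_ltl w \<phi>}"

(* prefix i w consists of the first i letters of w, i.e. it is w[0,i-1];
   restrict a Z is a.Z. *)
definition dependent_on :: "'v set \<Rightarrow> 'v set \<Rightarrow> 'v ltl \<Rightarrow> 'v set \<Rightarrow> 'v set \<Rightarrow> bool" where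
  "dependent_on Inp Out \<phi> X Y \<longleftrightarrow>
     X \<subseteq> Out \<and>
     (\<forall>w \<in> language (Inp \<union> Out) \<phi>. \<forall>w' \<in> language (Inp \<union> Out) \<phi>. \<forall>i.
        prefix i w = prefix i w' \<and> restrict (w i) Y = restrict (w' i) Y
        \<longrightarrow> restrict (w i) X = restrict (w' i) X)"

definition dependent_in :: "'v set \<Rightarrow> 'v set \<Rightarrow> 'v ltl \<Rightarrow> 'v set \<Rightarrow> bool" where
  "dependent_in Inp Out \<phi> X \<longleftrightarrow> dependent_on Inp Out \<phi> X ((Inp \<union> Out) - X)"

definition maximal_dependent :: "'v set \<Rightarrow> 'v set \<Rightarrow> 'v ltl \<Rightarrow> 'v set \<Rightarrow> bool" where
  "maximal_dependent Inp Out \<phi> X \<longleftrightarrow>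
     dependent_in Inp Out \<phi> X \<and>
     \<not> (\<exists>X'. X' \<subseteq> Out \<and> X \<subset> X' \<and> dependent_in Inp Out \<phi> X')"

(* The list zs is the order in which the output variables are considered. *)
definition find_dependent :: "('v \<Rightarrow> 'v set \<Rightarrow> bool) \<Rightarrow> 'v set \<Rightarrow> 'v list \<Rightarrow> 'v set" where
  "find_dependent isDependent V zs =
     fold (\<lambda>z X. if isDependent z (V - (X \<union> {z})) then X \<union> {z} else X) zs {}"

end

theory Submission imports Defs begin

text \<open>
  Dependence is monotone in the determining set. Hence, if some dependent \<open>X' \<supset> X\<close> existed, any
  \<open>z \<in> X' - X\<close> would be dependent on \<open>V - (X \<union> {z}) \<supseteq> V - X'\<close>; and a variable rejected at some
  stage would still be rejected after \<open>X\<close> has grown, so one pass over the outputs suffices.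
\<close>

lemma restrict_eq_iff: "restrict f A = restrict g A \<longleftrightarrow> (\<forall>x\<in>A. f x = g x)"
  by (auto simp: fun_eq_iff restrict_def)

lemma dependent_on_mono:
  assumes "dependent_on Inp Out \<phi> X Y" "X' \<subseteq> X" "Y \<subseteq> Y'"
  shows "dependent_on Inp Out \<phi> X' Y'"
  unfolding dependent_on_def restrict_eq_iff
proof (intro conjI ballI allI impI)
  show "X' \<subseteq> Out"
    using assms(1,2) by (auto simp: dependent_on_def)
next
  fix w w' i x
  assume w: "w \<in> language (Inp \<union> Out) \<phi>" "w' \<in> language (Inp \<union> Out) \<phi>"
    and agree: "prefix i w = prefix i w' \<and> (\<forall>y\<in>Y'. w i y = w' i y)"
    and x: "x \<in> X'"
  have "\<forall>y\<in>Y. w i y = w' i y"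
    using agree \<open>Y \<subseteq> Y'\<close> by blast
  then have "\<forall>y\<in>X. w i y = w' i y"
    using assms(1) w agree unfolding dependent_on_def restrict_eq_iff by blast
  with x \<open>X' \<subseteq> X\<close> show "w i x = w' i x"
    by blast
qed

lemma dependent_in_empty: "dependent_in Inp Out \<phi> {}"
  by (simp add: dependent_in_def dependent_on_def restrict_eq_iff)

text \<open>The two dependences are used in a fixed order: agreement outside
  \<open>insert z X\<close> first forces agreement at \<open>z\<close>, which then completes it to
  agreement on all of \<open>V - X\<close>, the premise under which \<open>X\<close> is
  determined.\<close>

lemma dependent_in_insert:
  assumes X: "dependent_in Inp Out \<phi> X"
    and z: "dependent_on Inp Out \<phi> {z} ((Inp \<union> Out) - insert z X)"
  shows "dependent_in Inp Out \<phi> (insert z X)"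
  unfolding dependent_in_def dependent_on_def restrict_eq_iff
proof (intro conjI ballI allI impI)
  show "insert z X \<subseteq> Out"
    using X z by (auto simp: dependent_in_def dependent_on_def)
next
  fix w w' i x
  assume w: "w \<in> language (Inp \<union> Out) \<phi>" "w' \<in> language (Inp \<union> Out) \<phi>"
    and agree: "prefix i w = prefix i w' \<and> (\<forall>y\<in>Inp \<union> Out - insert z X. w i y = w' i y)"
    and x: "x \<in> insert z X"
  have wz: "w i z = w' i z"
    using z w agree unfolding dependent_on_def restrict_eq_iff by blast
  with agree have "\<forall>y\<in>Inp \<union> Out - X. w i y = w' i y"
    by blast
  with X w agree have "\<forall>y\<in>X. w i y = w' i y"
    unfolding dependent_in_def dependent_on_def restrict_eq_iff by blast
  with wz x show "w i x = w' i x"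
    by blast
qed

text \<open>Reduces a claim about all larger sets to tests on single variables, the only ones the
  procedure makes.\<close>

lemma maximal_dependentI:
  assumes "dependent_in Inp Out \<phi> X"
    and rejected: "\<And>z. z \<in> Out - X \<Longrightarrow> \<not> dependent_on Inp Out \<phi> {z} ((Inp \<union> Out) - insert z X)"
  shows "maximal_dependent Inp Out \<phi> X"
  unfolding maximal_dependent_def
proof (intro conjI notI)
  assume "\<exists>X'. X' \<subseteq> Out \<and> X \<subset> X' \<and> dependent_in Inp Out \<phi> X'"
  then obtain X' z where "X' \<subseteq> Out" "X \<subset> X'" "z \<in> X' - X"
    and X': "dependent_on Inp Out \<phi> X' ((Inp \<union> Out) - X')"
    unfolding dependent_in_def by blast
  with dependent_on_mono [OF X', of "{z}" "(Inp \<union> Out) - insert z X"] rejected [of z]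
  show False
    by blast
qed fact

text \<open>Only \<open>set zs \<subseteq> Out\<close> is assumed, so that the claim applies to
  every initial segment of the order. Rejection is measured against the current \<open>X zs\<close>,
  not the smaller set present when the variable was tested.\<close>

lemma find_dependent_invariant:
  assumes "\<And>z Y. z \<in> Out \<Longrightarrow> Y \<subseteq> Inp \<union> Out \<Longrightarrow>
             isDependent z Y \<longleftrightarrow> dependent_on Inp Out \<phi> {z} Y"
    and "set zs \<subseteq> Out"
  defines "X \<equiv> find_dependent isDependent (Inp \<union> Out)"
  shows "dependent_in Inp Out \<phi> (X zs) \<and>
    (\<forall>z\<in>set zs - X zs. \<not> dependent_on Inp Out \<phi> {z} ((Inp \<union> Out) - insert z (X zs)))"
  using \<open>set zs \<subseteq> Out\<close>
\<comment> \<open>\<open>fold\<close> runs from the left, so the last element of the list is the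
  last variable tested.\<close>
proof (induction zs rule: rev_induct)
  case Nil
  show ?case
    by (simp add: X_def find_dependent_def dependent_in_empty)
next
  case (snoc a zs)
  let ?D = "\<lambda>z Y. dependent_on Inp Out \<phi> {z} ((Inp \<union> Out) - insert z Y)"
  have X_snoc: "X (zs @ [a]) = (if ?D a (X zs) then insert a (X zs) else X zs)"
    using assms(1) [of a "(Inp \<union> Out) - insert a (X zs)"] snoc.prems
    by (simp add: X_def find_dependent_def)
  have IH: "dependent_in Inp Out \<phi> (X zs)" "\<And>z. z \<in> set zs - X zs \<Longrightarrow> \<not> ?D z (X zs)"
    using snoc by auto
  show ?case
  proof (cases "?D a (X zs)")
    case True
    \<comment> \<open>Accepting \<open>a\<close> can only shrink the determining set of
      \<open>z\<close>; monotonicity is used by contraposition.\<close>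
    have "\<not> ?D z (insert a (X zs))" if "z \<in> set zs - X zs" for z
      using IH(2) [OF that]
        dependent_on_mono [of Inp Out \<phi> "{z}" _ "{z}" "Inp \<union> Out - insert z (X zs)"]
      by blast
    with True IH(1) show ?thesis
      by (auto simp: X_snoc dependent_in_insert)
  next
    case False
    \<comment> \<open>\<open>X\<close> is unchanged, and the failed test of \<open>a\<close> is
      itself the new instance of the invariant.\<close>
    with IH show ?thesis
      by (auto simp: X_snoc)
  qed
qed

theorem theorem5:
  fixes Inp Out :: "'v set" and \<phi> :: "'v ltl"
    and isDependent :: "'v \<Rightarrow> 'v set \<Rightarrow> bool" and zs :: "'v list"
  assumes "set_ltl \<phi> \<subseteq> Inp \<union> Out"
    and "\<And>z Y. z \<in> Out \<Longrightarrow> Y \<subseteq> Inp \<union> Out \<Longrightarrow>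
           isDependent z Y \<longleftrightarrow> dependent_on Inp Out \<phi> {z} Y"
    and "distinct zs" and "set zs = Out"
  shows "maximal_dependent Inp Out \<phi> (find_dependent isDependent (Inp \<union> Out) zs)"
proof -
  have "set zs \<subseteq> Out"
    using assms(4) by simp
  from find_dependent_invariant [of Out Inp isDependent \<phi>, OF assms(2) this]
  show ?thesis
    \<comment> \<open>As the list exhausts \<open>Out\<close>, the rejected variables are exactly
      those of \<open>Out\<close> outside the result.\<close>
    unfolding assms(4) by (intro maximal_dependentI) blast+
qed

end
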